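(* Consider a geometric grid of candidate valley sizes $\mathcal G=\{r_j=r_{\min}(1+\gamma)^j\}_{j=0}^J$ with $r_{\min},\gamma>0$, where each $r_j=\lambda_j/\alpha_j$ for a pull strength $\alpha_j>0$ and push strength $\lambda_j>0$ chosen before seeing the data. For every $r_j\in\mathcal G$ let the prior be the spherical Gaussian $P_{r_j}=\mathcal N(0,r_j\sigma_0^2I_d)$ on $\mathbb{R}^d$, and let the training algorithm return the posterior $Q_{r_j}=\mathcal N(\mu_{r_j},c_{r_j}r_j\sigma_0^2I_d)$ over model parameters, where $c_{r_j}\ge1$ is a data-dependent scalar. Assume there are constants $D_0>0$ and $0\le\beta<1$ such that $\|\mu_{r_j}\|_2^2\le D_0\,r_j^{\beta}$ for every $r_j\in\mathcal G$. Then with probability at least $1-\delta$ over the draw of the sample set $S$ with $|S|=n$, for all $r_j\in\mathcal G$, $$\mathbb{E}_{x\sim Q_{r_j}}[L_{\mathcal D}(x)]\le\mathbb{E}_{x\sim Q_{r_j}}[L_S(x)]+\mathrm{gap}(r_j),$$ where $$\mathrm{gap}(r_j)=\sqrt{\frac{\tfrac d2\bigl(c_{r_j}-1-\log c_{r_j}\bigr)+\dfrac{D_0}{2\sigma_0^2r_j^{1-\beta}}+\log\dfrac{nJ}{\delta}}{2(n-1)}} .$$ Moreover, because $1-\beta>0$, $\mathrm{gap}(r_{j+1})<\mathrm{gap}(r_j)$ for every consecutive pair $r_j,r_{j+1}$ in $\mathcal G$.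
   Context: $S$ is a training set of $n$ i.i.d. samples from a data distribution $\mathcal D$; for model parameters $x\in\mathbb{R}^d$, $L_{\mathcal D}(x)$ is the expected loss under $\mathcal D$ and $L_S(x)$ is the average loss over $S$. $\sigma_0>0$ is a fixed constant, $\delta\in(0,1)$, and $I_d$ is the $d\times d$ identity. In DPPF, a distributed training algorithm in which each worker is pulled toward the workers' average with strength $\alpha$ and pushed away from it (along the unit direction from the average) with strength $\lambda$, the valley size (radius) is identified with the ratio $r=\lambda/\alpha$; the hyperparameters $\lambda,\alpha$ are set without seeing the data. The posterior mean $\mu_{r_j}$ and the scalar $c_{r_j}$ may depend on $S$.
   Formalization: The loss is assumed to take values in [0,1] (the bound fails for unbounded losses), with n ≥ 2 and J ≥ 1; gap(r_{j+1}) < gap(r_j) is claimed only for consecutive pairs with c_{r_{j+1}} ≤ c_{r_j}, since it fails when c increases enough. *)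

theory Defs
  imports "HOL-Probability.Probability"
begin

text \<open>The normal distribution on \<open>\<real>\<^sup>d\<close> with mean \<open>\<mu>\<close> and covariance matrix \<open>v I\<^sub>d\<close>, for \<open>v > 0\<close>:
  the parameter \<open>v\<close> is the variance, not the standard deviation.\<close>

definition spherical_gaussian :: "real ^ 'd \<Rightarrow> real \<Rightarrow> (real ^ 'd) measure" where
  "spherical_gaussian \<mu> v = density lborel
     (\<lambda>x. ennreal (exp (- (norm (x - \<mu>))\<^sup>2 / (2 * v)) / sqrt (2 * pi * v) ^ CARD('d)))"

lemma prob_space_spherical_gaussian:
  fixes \<mu> :: "real ^ 'd"
  assumes v: "v > 0"
  shows "prob_space (spherical_gaussian \<mu> v)"
proof
  have density_eq: "ennreal (exp (- (norm (x - \<mu>))\<^sup>2 / (2 * v)) / sqrt (2 * pi * v) ^ CARD('d))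
      = (\<Prod>b\<in>Basis. ennreal (normal_density (\<mu> \<bullet> b) (sqrt v) (x \<bullet> b)))" for x
  proof -
    have "(norm (x - \<mu>))\<^sup>2 = (\<Sum>b\<in>Basis. (x \<bullet> b - \<mu> \<bullet> b)\<^sup>2)"
      by (simp only: power2_norm_eq_inner euclidean_inner[of "x - \<mu>" "x - \<mu>"])
         (simp add: power2_eq_square inner_diff_left)
    then have "exp (- (norm (x - \<mu>))\<^sup>2 / (2 * v))
        = (\<Prod>b\<in>(Basis :: (real ^ 'd) set). exp (- (x \<bullet> b - \<mu> \<bullet> b)\<^sup>2 / (2 * v)))"
      by (simp add: exp_sum[symmetric] sum_negf[symmetric] sum_divide_distrib)
    moreover have "sqrt (2 * pi * v) ^ CARD('d) = (\<Prod>b\<in>(Basis :: (real ^ 'd) set). sqrt (2 * pi * v))"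
      by simp
    ultimately show ?thesis
      using v by (simp only: prod_dividef[symmetric])
        (subst prod_ennreal, auto simp: normal_density_def)
  qed
  have one: "(\<integral>\<^sup>+ y. ennreal (normal_density m (sqrt v) y) \<partial>lborel) = 1" for m
  proof -
    interpret N: prob_space "density lborel (normal_density m (sqrt v))"
      using v by (intro prob_space_normal_density) simp
    show ?thesis
      using N.emeasure_space_1 by (simp add: emeasure_density)
  qed
  have "(\<integral>\<^sup>+ x. (\<Prod>b\<in>Basis. ennreal (normal_density (\<mu> \<bullet> b) (sqrt v) (x \<bullet> b))) \<partial>lborel) = 1"
    by (subst nn_integral_lborel_prod) (auto simp: one)
  then show "emeasure (spherical_gaussian \<mu> v) (space (spherical_gaussian \<mu> v)) = 1"
    by (simp add: spherical_gaussian_def emeasure_density flip: density_eq)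
qed

definition population_loss :: "'z measure \<Rightarrow> ('x \<Rightarrow> 'z \<Rightarrow> real) \<Rightarrow> 'x \<Rightarrow> real" where
  "population_loss D loss x = (\<integral>z. loss x z \<partial>D)"

definition empirical_loss :: "nat \<Rightarrow> ('x \<Rightarrow> 'z \<Rightarrow> real) \<Rightarrow> (nat \<Rightarrow> 'z) \<Rightarrow> 'x \<Rightarrow> real" where
  "empirical_loss n loss S x = (\<Sum>i<n. loss x (S i)) / real n"

text \<open>The samples of size \<open>n\<close> are the functions on \<open>{..<n}\<close> in the product space.\<close>

abbreviation iid_samples :: "nat \<Rightarrow> 'z measure \<Rightarrow> (nat \<Rightarrow> 'z) measure" where
  "iid_samples n D \<equiv> Pi\<^sub>M {..<n} (\<lambda>_. D)"

text \<open>The terms preceding the logarithm of \<open>n J / \<delta>\<close> bound the Kullback-Leibler divergence of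
  \<open>N(\<mu>, c r \<sigma>\<^sub>0\<^sup>2 I\<^sub>d)\<close> from \<open>N(0, r \<sigma>\<^sub>0\<^sup>2 I\<^sub>d)\<close> when \<open>\<parallel>\<mu>\<parallel>\<^sup>2 \<le> D\<^sub>0 r\<^sup>\<beta>\<close>.\<close>

definition gap ::
    "nat \<Rightarrow> nat \<Rightarrow> nat \<Rightarrow> real \<Rightarrow> real \<Rightarrow> real \<Rightarrow> real \<Rightarrow> real \<Rightarrow> real \<Rightarrow> real" where
  "gap d n J \<delta> \<sigma>\<^sub>0 D\<^sub>0 \<beta> c r =
     sqrt ((real d / 2 * (c - 1 - ln c)
            + D\<^sub>0 / (2 * \<sigma>\<^sub>0\<^sup>2 * r powr (1 - \<beta>))
            + ln (real n * real J / \<delta>))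
           / (2 * (real n - 1)))"

end

(* Change of measure turns an exponential moment of a convex function f of the deviation under the
   prior into a bound on f of the posterior mean deviation, at the price of the Gaussian
   Kullback-Leibler divergence. Markov's inequality for the sum of the J + 1 prior averages makes
   this hold for the whole grid at once, with an additional ln ((J + 1) m / \<delta>), where m bounds
   the exponential moment. Only ln (n J / \<delta>) is available, so the usual m of order n is too
   large; the sharp sub-Gaussian estimate m = sqrt n for f t = 2 (n - 1) t\<^sup>2 fits unless n \<le> 3. *)
theory Submission imports Defs begin

text \<open>The posterior is chosen after the data are seen, so it must not enter the random event.
  The event \<open>E\<close> restrains only averages over the priors, which are fixed measures; on
  each sample in \<open>E\<close> the change of measure is then a deterministic inequality, valid
  for every mean and every scale at once. No measurability of \<open>train\<close>,
  \<open>\<mu>\<close> or \<open>c\<close> in the sample is assumed, so the samples satisfying the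
  bound need not form a measurable set; hence the conclusion asserts a measurable \<open>E\<close>
  on which the bound holds. The coefficient \<open>2 * (n - 1)\<close> sits just below the critical
  \<open>2 * n\<close>: a deviation that is sub-Gaussian with variance proxy 1 / (4 n) has square
  exponential moment at most (1 - (n - 1) / n) to the power -1/2, which is \<open>sqrt n\<close>,
  whereas at \<open>2 * n\<close> this estimate diverges.\<close>

section \<open>Second moments of the spherical Gaussian\<close>

lemma spherical_gaussian_density_prod:
  fixes \<mu> x :: "real ^ 'd"
  assumes "v > 0"
  shows "ennreal (exp (- (norm (x - \<mu>))\<^sup>2 / (2 * v)) / sqrt (2 * pi * v) ^ CARD('d))
    = (\<Prod>b\<in>Basis. ennreal (normal_density (\<mu> \<bullet> b) (sqrt v) (x \<bullet> b)))"
proof -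
  have "(norm (x - \<mu>))\<^sup>2 = (\<Sum>b\<in>Basis. (x \<bullet> b - \<mu> \<bullet> b)\<^sup>2)"
    by (simp only: power2_norm_eq_inner euclidean_inner[of "x - \<mu>" "x - \<mu>"])
       (simp add: power2_eq_square inner_diff_left)
  then have "exp (- (norm (x - \<mu>))\<^sup>2 / (2 * v))
      = (\<Prod>b\<in>(Basis :: (real ^ 'd) set). exp (- (x \<bullet> b - \<mu> \<bullet> b)\<^sup>2 / (2 * v)))"
    by (simp add: exp_sum sum_negf[symmetric] sum_divide_distrib)
  then show ?thesis
    using assms by (simp add: normal_density_def prod_ennreal prod_dividef)
qed

lemma nn_integral_normal_density:
  assumes "\<sigma> > 0"
  shows "(\<integral>\<^sup>+ y. ennreal (normal_density m \<sigma> y) \<partial>lborel) = 1"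
  using assms by (subst nn_integral_eq_integral) auto

lemma nn_integral_normal_second_moment:
  assumes "\<sigma> > 0"
  shows "(\<integral>\<^sup>+ y. ennreal (normal_density m \<sigma> y * (y - a)\<^sup>2) \<partial>lborel) = ennreal (\<sigma>\<^sup>2 + (m - a)\<^sup>2)"
proof -
  have 0: "has_bochner_integral lborel (normal_density m \<sigma>) 1"
    and 1: "has_bochner_integral lborel (\<lambda>y. normal_density m \<sigma> y * (y - m)) 0"
    and 2: "has_bochner_integral lborel (\<lambda>y. normal_density m \<sigma> y * (y - m)\<^sup>2) (\<sigma>\<^sup>2)"
    using normal_moment_even[OF assms, of m 0] normal_moment_odd[OF assms, of m 0]
      normal_moment_even[OF assms, of m 1] by (simp_all add: power2_eq_square)
  have "has_bochner_integral lborel (\<lambda>y. normal_density m \<sigma> y * (y - m)\<^sup>2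
      + normal_density m \<sigma> y * (y - m) * (2 * (m - a)) + normal_density m \<sigma> y * (m - a)\<^sup>2)
      (\<sigma>\<^sup>2 + 0 * (2 * (m - a)) + 1 * (m - a)\<^sup>2)"
    by (intro has_bochner_integral_add has_bochner_integral_mult_left 0 1 2)
  also have "(\<lambda>y. normal_density m \<sigma> y * (y - m)\<^sup>2
      + normal_density m \<sigma> y * (y - m) * (2 * (m - a)) + normal_density m \<sigma> y * (m - a)\<^sup>2)
    = (\<lambda>y. normal_density m \<sigma> y * (y - a)\<^sup>2)"
    by (auto simp: power2_eq_square algebra_simps)
  finally have "has_bochner_integral lborel (\<lambda>y. normal_density m \<sigma> y * (y - a)\<^sup>2) (\<sigma>\<^sup>2 + (m - a)\<^sup>2)"
    by simp
  then show ?thesis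
    by (auto simp: has_bochner_integral_iff nn_integral_eq_integral)
qed

lemma sets_spherical_gaussian [simp, measurable_cong]: "sets (spherical_gaussian \<mu> v) = sets borel"
  and space_spherical_gaussian [simp]: "space (spherical_gaussian \<mu> v) = UNIV"
  by (simp_all add: spherical_gaussian_def)

text \<open>The weight depends on coordinate \<open>i\<close> alone, so it is absorbed into one
  factor of the product density, and all other factors integrate to 1.\<close>

lemma nn_integral_spherical_gaussian_coordinate:
  fixes \<mu> :: "real ^ 'd"
  assumes v: "v > 0" and i: "i \<in> Basis"
  shows "(\<integral>\<^sup>+ x. ennreal ((x \<bullet> i - a)\<^sup>2) \<partial>spherical_gaussian \<mu> v) = ennreal (v + (\<mu> \<bullet> i - a)\<^sup>2)"
proof -
  define f where "f b y = ennreal (normal_density (\<mu> \<bullet> b) (sqrt v) y * (if b = i then (y - a)\<^sup>2 else 1))"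
    for b y
  have *: "(\<Prod>b\<in>Basis. ennreal (normal_density (\<mu> \<bullet> b) (sqrt v) (x \<bullet> b))) * ennreal ((x \<bullet> i - a)\<^sup>2)
      = (\<Prod>b\<in>Basis. f b (x \<bullet> b))" for x :: "real ^ 'd"
    using i by (simp add: f_def ennreal_mult prod.distrib if_distrib[where f = ennreal] cong: if_cong)
  have int: "(\<integral>\<^sup>+y. f b y \<partial>lborel) = ennreal (if b = i then v + (\<mu> \<bullet> i - a)\<^sup>2 else 1)" for b
    using v by (simp add: f_def nn_integral_normal_density nn_integral_normal_second_moment)
  have "(\<integral>\<^sup>+ x. ennreal ((x \<bullet> i - a)\<^sup>2) \<partial>spherical_gaussian \<mu> v)
      = (\<integral>\<^sup>+x. (\<Prod>b\<in>Basis. f b (x \<bullet> b)) \<partial>lborel)"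
    by (simp add: spherical_gaussian_def nn_integral_density)
       (simp only: minus_divide_left spherical_gaussian_density_prod[OF v] *)
  also have "\<dots> = (\<Prod>b\<in>(Basis :: (real ^ 'd) set). (\<integral>\<^sup>+y. f b y \<partial>lborel))"
    by (rule nn_integral_lborel_prod) (auto simp: f_def)
  also have "\<dots> = ennreal (v + (\<mu> \<bullet> i - a)\<^sup>2)"
    using i by (simp add: int if_distrib[where f = ennreal] cong: if_cong)
  finally show ?thesis .
qed

text \<open>The centre \<open>a\<close> is arbitrary because the log density ratio of posterior to
  prior contains squared distances both to 0 and to the posterior mean.\<close>

lemma spherical_gaussian_second_moment:
  fixes \<mu> a :: "real ^ 'd" and v :: real
  assumes v: "v > 0"
  shows "has_bochner_integral (spherical_gaussian \<mu> v) (\<lambda>x. (norm (x - a))\<^sup>2)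
    (CARD('d) * v + (norm (\<mu> - a))\<^sup>2)"
proof (rule has_bochner_integral_nn_integral)
  have norm_eq: "(norm (x - a))\<^sup>2 = (\<Sum>b\<in>Basis. (x \<bullet> b - a \<bullet> b)\<^sup>2)" for x
    by (simp only: power2_norm_eq_inner euclidean_inner[of "x - a" "x - a"])
       (simp add: power2_eq_square inner_diff_left)
  have "(\<integral>\<^sup>+x. ennreal ((norm (x - a))\<^sup>2) \<partial>spherical_gaussian \<mu> v)
      = (\<Sum>b\<in>Basis. \<integral>\<^sup>+x. ennreal ((x \<bullet> b - a \<bullet> b)\<^sup>2) \<partial>spherical_gaussian \<mu> v)"
    unfolding norm_eq by (subst nn_integral_sum[symmetric]) (auto simp: sum_ennreal)
  also have "\<dots> = (\<Sum>b\<in>(Basis :: (real ^ 'd) set). ennreal (v + (\<mu> \<bullet> b - a \<bullet> b)\<^sup>2))"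
    using v by (intro sum.cong refl nn_integral_spherical_gaussian_coordinate) auto
  also have "\<dots> = ennreal (CARD('d) * v + (norm (\<mu> - a))\<^sup>2)"
    unfolding norm_eq using v by (subst sum_ennreal) (auto simp: sum.distrib)
  finally show "(\<integral>\<^sup>+x. ennreal ((norm (x - a))\<^sup>2) \<partial>spherical_gaussian \<mu> v)
      = ennreal (CARD('d) * v + (norm (\<mu> - a))\<^sup>2)" .
qed (use v in auto)

section \<open>Change of measure and the Gaussian Kullback-Leibler divergence\<close>

text \<open>One half of the Donsker-Varadhan formula: \<open>k\<close> is the log density of
  \<open>Q\<close>, so its integral under \<open>Q\<close> is the Kullback-Leibler divergence.
  Writing the density as \<open>exp (k x)\<close> makes it positive everywhere, so that it can be
  cancelled pointwise.\<close>

lemma (in prob_space) change_of_measure_le: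
  fixes h k :: "'a \<Rightarrow> real"
  defines "Q \<equiv> density M (\<lambda>x. ennreal (exp (k x)))"
  assumes Q: "prob_space Q" and k: "integrable Q k" and km [measurable]: "k \<in> borel_measurable M"
    and hm [measurable]: "h \<in> borel_measurable M" and B: "\<And>x. x \<in> space M \<Longrightarrow> \<bar>h x\<bar> \<le> B"
  shows "(\<integral>x. h x \<partial>Q) \<le> (\<integral>x. k x \<partial>Q) + ln (\<integral>x. exp (h x) \<partial>M)"
proof -
  interpret Q: prob_space Q by fact
  define Z where "Z = (\<integral>x. exp (h x) \<partial>M)"
  have int_exp: "integrable M (\<lambda>x. exp (h x))"
    using B by (intro integrable_const_bound[where B = "exp B"]) (auto simp: abs_le_iff)
  have "exp (- B) \<le> Z"
    unfolding Z_def using B by (intro integral_ge_const int_exp) (auto simp: abs_le_iff minus_le_iff)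
  then have Z: "Z > 0"
    by (rule less_le_trans[rotated]) simp
  have int_h: "integrable Q h"
    using B by (intro Q.integrable_const_bound[where B = B]) (auto simp: Q_def)
  have cancel: "exp (k x) * exp (h x - k x - ln Z) = exp (h x) / Z" for x
    using Z by (simp add: exp_diff)
  have 1: "integrable Q (\<lambda>x. exp (h x - k x - ln Z))"
    unfolding Q_def using int_exp by (subst integrable_density) (auto simp: cancel)
  have 2: "(\<integral>x. exp (h x - k x - ln Z) \<partial>Q) = 1"
    unfolding Q_def using Z by (subst integral_density) (auto simp: cancel Z_def[symmetric])
  \<comment> \<open>The tangent inequality \<open>u \<le> exp u - 1\<close> replaces Jensen for the
    logarithm. Subtracting \<open>ln Z\<close> normalises \<open>exp u\<close> to have integral 1,
    so the right-hand side integrates to 0.\<close>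
  have "(\<integral>x. h x - k x - ln Z \<partial>Q) \<le> (\<integral>x. exp (h x - k x - ln Z) - 1 \<partial>Q)"
  proof (rule integral_mono)
    show "h x - k x - ln Z \<le> exp (h x - k x - ln Z) - 1" for x
      using exp_ge_add_one_self[of "h x - k x - ln Z"] by linarith
  qed (use int_h k 1 in auto)
  then show ?thesis
    using int_h k 1 2 by (simp add: Z_def Q.prob_space)
qed

text \<open>The exponent is the \<open>k\<close> to be used in the change of measure; its term with
  \<open>ln c\<close> is the ratio of the normalising constants.\<close>

lemma spherical_gaussian_eq_density:
  fixes \<mu> :: "real ^ 'd"
  assumes v: "v > 0" and c: "c > 0"
  shows "spherical_gaussian \<mu> (c * v) = density (spherical_gaussian 0 v)
    (\<lambda>x. ennreal (exp ((norm x)\<^sup>2 / (2 * v) - (norm (x - \<mu>))\<^sup>2 / (2 * (c * v)) - CARD('d) / 2 * ln c)))"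
proof -
  have sqrt_c: "exp (real CARD('d) / 2 * ln c) = sqrt c ^ CARD('d)"
    using c by (simp add: powr_half_sqrt[symmetric] powr_realpow[symmetric] powr_powr powr_def)
  have *: "exp (- (norm (x - \<mu>))\<^sup>2 / (2 * (c * v))) / sqrt (2 * pi * (c * v)) ^ CARD('d)
    = exp (- (norm (x - 0))\<^sup>2 / (2 * v)) / sqrt (2 * pi * v) ^ CARD('d)
      * exp ((norm x)\<^sup>2 / (2 * v) - (norm (x - \<mu>))\<^sup>2 / (2 * (c * v)) - CARD('d) / 2 * ln c)"
    for x :: "real ^ 'd"
  proof -
    define A B where "A = (norm x)\<^sup>2 / (2 * v)" and "B = (norm (x - \<mu>))\<^sup>2 / (2 * (c * v))"
    have "sqrt (2 * pi * (c * v)) ^ CARD('d) = sqrt c ^ CARD('d) * sqrt (2 * pi * v) ^ CARD('d)"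
      by (simp add: real_sqrt_mult power_mult_distrib)
    then have "exp (- B) / sqrt (2 * pi * (c * v)) ^ CARD('d)
        = exp (- A) / sqrt (2 * pi * v) ^ CARD('d) * (exp A / exp B / sqrt c ^ CARD('d))"
      by (simp add: exp_minus inverse_eq_divide)
    then show ?thesis
      using sqrt_c by (simp add: A_def B_def exp_diff)
  qed
  show ?thesis
    unfolding spherical_gaussian_def * using v
    by (subst ennreal_mult) (auto intro!: density_density_eq[symmetric])
qed

text \<open>Under the posterior the first square in \<open>k\<close> contributes d c / 2 plus the
  term with \<open>norm \<mu>\<close>, and the second contributes exactly d / 2, where d is the
  dimension. Together with the term with \<open>ln c\<close> this is the exact divergence from the
  prior.\<close>

lemma spherical_gaussian_change_of_measure_le:
  fixes \<mu> :: "real ^ 'd"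
  assumes v: "v > 0" and c: "c > 0"
    and h [measurable]: "h \<in> borel_measurable borel" and B: "\<And>x. \<bar>h x\<bar> \<le> B"
  shows "(\<integral>x. h x \<partial>spherical_gaussian \<mu> (c * v))
    \<le> CARD('d) / 2 * (c - 1 - ln c) + (norm \<mu>)\<^sup>2 / (2 * v) + ln (\<integral>x. exp (h x) \<partial>spherical_gaussian 0 v)"
proof -
  let ?Q = "spherical_gaussian \<mu> (c * v)"
  define k where "k x = (norm x)\<^sup>2 / (2 * v) - (norm (x - \<mu>))\<^sup>2 / (2 * (c * v)) - CARD('d) / 2 * ln c"
    for x :: "real ^ 'd"
  have cv: "c * v > 0"
    using v c by simp
  interpret P: prob_space "spherical_gaussian (0 :: real ^ 'd) v"
    using v by (rule prob_space_spherical_gaussian)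
  interpret Q: prob_space ?Q
    using cv by (rule prob_space_spherical_gaussian)
  have Q: "?Q = density (spherical_gaussian 0 v) (\<lambda>x. ennreal (exp (k x)))"
    unfolding k_def using v c by (rule spherical_gaussian_eq_density)
  have 1: "has_bochner_integral ?Q (\<lambda>x. (norm x)\<^sup>2) (CARD('d) * (c * v) + (norm \<mu>)\<^sup>2)"
    using spherical_gaussian_second_moment[OF cv, of \<mu> 0] by simp
  have 2: "has_bochner_integral ?Q (\<lambda>x. (norm (x - \<mu>))\<^sup>2) (CARD('d) * (c * v))"
    using spherical_gaussian_second_moment[OF cv, of \<mu> \<mu>] by simp
  have 3: "has_bochner_integral ?Q (\<lambda>x. CARD('d) / 2 * ln c) (CARD('d) / 2 * ln c)"
    using Q.prob_space by (simp add: has_bochner_integral_iff)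
  have "has_bochner_integral ?Q k ((CARD('d) * (c * v) + (norm \<mu>)\<^sup>2) / (2 * v)
      - CARD('d) * (c * v) / (2 * (c * v)) - CARD('d) / 2 * ln c)"
    unfolding k_def by (intro has_bochner_integral_diff has_bochner_integral_divide_zero 1 2 3)
  also have "(CARD('d) * (c * v) + (norm \<mu>)\<^sup>2) / (2 * v) - CARD('d) * (c * v) / (2 * (c * v))
      - CARD('d) / 2 * ln c = CARD('d) / 2 * (c - 1 - ln c) + (norm \<mu>)\<^sup>2 / (2 * v)"
    using v c by (simp add: field_simps)
  finally have k: "has_bochner_integral ?Q k (CARD('d) / 2 * (c - 1 - ln c) + (norm \<mu>)\<^sup>2 / (2 * v))" .
  have "(\<integral>x. h x \<partial>?Q) \<le> (\<integral>x. k x \<partial>?Q) + ln (\<integral>x. exp (h x) \<partial>spherical_gaussian 0 v)"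
    unfolding Q
  proof (rule P.change_of_measure_le)
    show "k \<in> borel_measurable (spherical_gaussian 0 v)"
      unfolding k_def by measurable
  qed (use B k Q.prob_space_axioms in \<open>auto simp flip: Q simp: has_bochner_integral_iff\<close>)
  then show ?thesis
    using k by (simp add: has_bochner_integral_iff)
qed

section \<open>Exponential moments of the deviation\<close>

text \<open>Hoeffding's lemma takes a positive slope, so it is applied to \<open>- X\<close> or to
  \<open>X\<close> according to the sign of \<open>l\<close>. Both signs occur later, when the slope
  is a multiple of a Gaussian variable.\<close>

lemma (in prob_space) mgf_centered_le:
  assumes X [measurable]: "X \<in> borel_measurable M" and bnd: "\<And>z. z \<in> space M \<Longrightarrow> 0 \<le> X z \<and> X z \<le> 1"
  shows "(\<integral>\<^sup>+z. ennreal (exp (l * (expectation X - X z))) \<partial>M) \<le> ennreal (exp (l\<^sup>2 / 8))"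
proof -
  consider "l > 0" | "l = 0" | "l < 0"
    by linarith
  then show ?thesis
  proof cases
    case 1
    interpret interval_bounded_random_variable M "\<lambda>z. - X z" "- 1" 0
      by unfold_locales (use bnd in auto)
    have "(\<integral>\<^sup>+z. ennreal (exp (l * (- X z - expectation (\<lambda>z. - X z)))) \<partial>M) \<le> ennreal (exp (l\<^sup>2 / 8))"
      using Hoeffdings_lemma_nn_integral[OF 1] by simp
    then show ?thesis
      by (simp add: algebra_simps)
  next
    case 2
    then show ?thesis
      by (simp add: emeasure_space_1)
  next
    case 3
    then have "- l > 0"
      by simp
    interpret interval_bounded_random_variable M X 0 1
      by unfold_locales (use bnd in auto)
    have "(\<integral>\<^sup>+z. ennreal (exp (- l * (X z - expectation X))) \<partial>M) \<le> ennreal (exp (l\<^sup>2 / 8))"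
      using Hoeffdings_lemma_nn_integral[OF \<open>- l > 0\<close>] by simp
    then show ?thesis
      by (simp add: algebra_simps)
  qed
qed

text \<open>Completing the square turns the integrand into a constant times the normal density with
  mean \<open>a\<close>.\<close>

lemma exp_half_square_eq_nn_integral:
  "ennreal (exp (a\<^sup>2 / 2)) = (\<integral>\<^sup>+g. ennreal (std_normal_density g * exp (a * g)) \<partial>lborel)"
proof -
  have "std_normal_density g * exp (a * g) = exp (a\<^sup>2 / 2) * normal_density a 1 g" for g
    by (simp add: normal_density_def exp_add[symmetric] power2_eq_square field_simps)
  then show ?thesis
    by (simp add: ennreal_mult nn_integral_cmult nn_integral_normal_density)
qed

text \<open>Joint measurability permits exchanging the integrals over samples and over parameters.
  The unit range of the loss fixes the constant 1/8 in Hoeffding's lemma.\<close>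

locale bounded_loss = prob_space D
  for D :: "'z measure" +
  fixes loss :: "'x :: second_countable_topology \<Rightarrow> 'z \<Rightarrow> real"
  assumes loss_measurable [measurable]: "(\<lambda>(x, z). loss x z) \<in> borel_measurable (borel \<Otimes>\<^sub>M D)"
    and loss_bounds: "z \<in> space D \<Longrightarrow> 0 \<le> loss x z \<and> loss x z \<le> 1"
begin

definition deviation :: "nat \<Rightarrow> (nat \<Rightarrow> 'z) \<Rightarrow> 'x \<Rightarrow> real" where
  "deviation n S x = population_loss D loss x - empirical_loss n loss S x"

lemma prob_space_iid_samples: "prob_space (iid_samples n D)"
  by (intro prob_space_PiM prob_space_axioms)

lemma loss_section_measurable [measurable]: "loss x \<in> borel_measurable D"
  using measurable_Pair2[OF loss_measurable, of x] by simp

lemma population_loss_measurable [measurable]: "population_loss D loss \<in> borel_measurable borel"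
  unfolding population_loss_def by measurable

lemma empirical_loss_measurable [measurable]:
  "(\<lambda>(S, x). empirical_loss n loss S x) \<in> borel_measurable (iid_samples n D \<Otimes>\<^sub>M borel)"
  unfolding empirical_loss_def by measurable

lemma deviation_measurable [measurable]:
  "(\<lambda>(S, x). deviation n S x) \<in> borel_measurable (iid_samples n D \<Otimes>\<^sub>M borel)"
  unfolding deviation_def by measurable

lemma population_loss_bounds: "0 \<le> population_loss D loss x" "population_loss D loss x \<le> 1"
proof -
  have "integrable D (loss x)"
    using loss_bounds by (intro integrable_const_bound[where B = 1]) auto
  then show "0 \<le> population_loss D loss x" "population_loss D loss x \<le> 1"
    using loss_bounds unfolding population_loss_def
    by (auto intro!: integral_ge_const integral_le_const)
qed

lemma empirical_loss_bounds:
  assumes "S \<in> space (iid_samples n D)"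
  shows "0 \<le> empirical_loss n loss S x" "empirical_loss n loss S x \<le> 1"
proof -
  have "0 \<le> loss x (S i) \<and> loss x (S i) \<le> 1" if "i < n" for i
    using assms that by (intro loss_bounds) (auto simp: space_PiM)
  then show "0 \<le> empirical_loss n loss S x" "empirical_loss n loss S x \<le> 1"
    unfolding empirical_loss_def
    using sum_bounded_above[of "{..<n}" "\<lambda>i. loss x (S i)" 1]
    by (auto intro!: divide_nonneg_nonneg sum_nonneg divide_le_eq_1[THEN iffD2])
qed

lemma deviation_bounds:
  assumes "S \<in> space (iid_samples n D)"
  shows "\<bar>deviation n S x\<bar> \<le> 1"
  using population_loss_bounds[of x] empirical_loss_bounds[OF assms, of x]
  by (simp add: deviation_def abs_le_iff)

text \<open>By independence the moment is a product of \<open>n\<close> Hoeffding factors, each with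
  slope \<open>l / n\<close>.\<close>

lemma mgf_deviation_le:
  assumes n: "n > 0"
  shows "(\<integral>\<^sup>+S. ennreal (exp (l * deviation n S x)) \<partial>iid_samples n D) \<le> ennreal (exp (l\<^sup>2 / (8 * real n)))"
proof -
  interpret product_sigma_finite "\<lambda>_ :: nat. D"
    by unfold_locales
  let ?L = "expectation (loss x)"
  have "(\<Sum>i<n. l / n * (?L - loss x (S i))) = l / n * (n * ?L - (\<Sum>i<n. loss x (S i)))" for S
    by (simp only: sum_distrib_left[symmetric] sum_subtractf sum_constant card_lessThan)
  then have "l * deviation n S x = (\<Sum>i<n. l / n * (?L - loss x (S i)))" for S
    using n by (simp add: deviation_def population_loss_def empirical_loss_def field_simps)
  then have "exp (l * deviation n S x) = (\<Prod>i<n. exp (l / n * (?L - loss x (S i))))" for S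
    by (simp only: exp_sum finite_lessThan)
  then have "(\<integral>\<^sup>+S. ennreal (exp (l * deviation n S x)) \<partial>iid_samples n D)
      = (\<integral>\<^sup>+S. (\<Prod>i<n. ennreal (exp (l / n * (?L - loss x (S i))))) \<partial>iid_samples n D)"
    by (simp add: prod_ennreal)
  also have "\<dots> = (\<integral>\<^sup>+z. ennreal (exp (l / n * (?L - loss x z))) \<partial>D) ^ n"
    by (subst product_nn_integral_prod) auto
  also have "\<dots> \<le> ennreal (exp ((l / n)\<^sup>2 / 8)) ^ n"
    using loss_bounds by (intro power_mono mgf_centered_le) auto
  also have "\<dots> = ennreal (exp (l\<^sup>2 / (8 * real n)))"
    using n by (simp add: ennreal_power exp_of_nat_mult[symmetric] power2_eq_square)
  finally show ?thesis .
qed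

text \<open>The square in the exponent is linearised by writing \<open>exp (a\<^sup>2 / 2)\<close> as the expectation of
  \<open>exp (a g)\<close> for a standard Gaussian \<open>g\<close>.\<close>

lemma exp_square_deviation_le:
  assumes n: "n > 0"
  shows "(\<integral>\<^sup>+S. ennreal (exp (2 * (real n - 1) * (deviation n S x)\<^sup>2)) \<partial>iid_samples n D) \<le> ennreal (sqrt n)"
proof -
  interpret S: prob_space "iid_samples n D"
    by (rule prob_space_iid_samples)
  interpret pair_sigma_finite "iid_samples n D" "lborel :: real measure"
    by unfold_locales
  define s where "s = 2 * sqrt (real n - 1)"
  have s2: "s\<^sup>2 = 4 * (real n - 1)"
    using n by (simp add: s_def power_mult_distrib)
  have "2 * (real n - 1) * d\<^sup>2 = (s * d)\<^sup>2 / 2" for d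
    by (simp add: power_mult_distrib s2 field_simps)
  then have "(\<integral>\<^sup>+S. ennreal (exp (2 * (real n - 1) * (deviation n S x)\<^sup>2)) \<partial>iid_samples n D)
      = (\<integral>\<^sup>+S. ennreal (exp ((s * deviation n S x)\<^sup>2 / 2)) \<partial>iid_samples n D)"
    by (simp only:)
  also have "\<dots> = (\<integral>\<^sup>+S. (\<integral>\<^sup>+g. ennreal (std_normal_density g * exp (s * deviation n S x * g)) \<partial>lborel)
      \<partial>iid_samples n D)"
    by (simp only: exp_half_square_eq_nn_integral)
  also have "\<dots> = (\<integral>\<^sup>+g. (\<integral>\<^sup>+S. ennreal (std_normal_density g * exp (s * deviation n S x * g))
      \<partial>iid_samples n D) \<partial>lborel)"
    by (rule Fubini'[symmetric]) measurable
  also have "\<dots> = (\<integral>\<^sup>+g. ennreal (std_normal_density g)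
      * (\<integral>\<^sup>+S. ennreal (exp (s * g * deviation n S x)) \<partial>iid_samples n D) \<partial>lborel)"
    by (simp add: ennreal_mult nn_integral_cmult ac_simps)
  also have "\<dots> \<le> (\<integral>\<^sup>+g. ennreal (std_normal_density g) * ennreal (exp ((s * g)\<^sup>2 / (8 * real n))) \<partial>lborel)"
    by (intro nn_integral_mono mult_left_mono mgf_deviation_le n) simp
  also have "\<dots> = (\<integral>\<^sup>+g. ennreal (sqrt n) * ennreal (normal_density 0 (sqrt n) g) \<partial>lborel)"
  proof (intro nn_integral_cong)
    fix g :: real
    \<comment> \<open>Since \<open>s\<^sup>2 = 4 * (n - 1)\<close>, the Hoeffding exponent cancels
      all but the fraction 1 / n of the Gaussian one. What remains is an unnormalised normal density
      of variance \<open>n\<close>, whose missing normalisation is the factor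
      \<open>sqrt n\<close>.\<close>
    have "- g\<^sup>2 / 2 + (s * g)\<^sup>2 / (8 * real n) = - g\<^sup>2 / (2 * real n)"
      using n by (simp add: power_mult_distrib s2 field_simps)
    then have "std_normal_density g * exp ((s * g)\<^sup>2 / (8 * real n)) = sqrt n * normal_density 0 (sqrt n) g"
      using n by (simp add: normal_density_def exp_add[symmetric] real_sqrt_mult)
    then show "ennreal (std_normal_density g) * ennreal (exp ((s * g)\<^sup>2 / (8 * real n)))
        = ennreal (sqrt n) * ennreal (normal_density 0 (sqrt n) g)"
      by (simp add: ennreal_mult[symmetric])
  qed
  also have "\<dots> = ennreal (sqrt n)"
    using n by (simp add: nn_integral_cmult nn_integral_normal_density)
  finally show ?thesis .
qed

section \<open>One event for all priors of the grid\<close>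

text \<open>The priors do not depend on the sample, so Tonelli transfers the moment bound from each
  single parameter to the prior average. The averages are nonnegative, hence a bound on their sum
  bounds each of them.\<close>

lemma prior_average_event:
  fixes J :: nat and m \<delta> :: real and P :: "nat \<Rightarrow> 'x measure"
  assumes P: "\<And>j. j \<le> J \<Longrightarrow> prob_space (P j)" and setsP: "\<And>j. j \<le> J \<Longrightarrow> sets (P j) = sets borel"
    and f [measurable]: "f \<in> borel_measurable borel"
    and m: "\<And>x. (\<integral>\<^sup>+S. ennreal (exp (f (deviation n S x))) \<partial>iid_samples n D) \<le> ennreal m"
    and "m > 0" "\<delta> > 0"
  obtains E where "E \<in> sets (iid_samples n D)" "measure (iid_samples n D) E \<ge> 1 - \<delta>"
    "\<And>S j. S \<in> E \<Longrightarrow> j \<le> J \<Longrightarrow>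
      (\<integral>\<^sup>+x. ennreal (exp (f (deviation n S x))) \<partial>P j) \<le> ennreal (real (Suc J) * m / \<delta>)"
proof -
  let ?M = "iid_samples n D"
  interpret S: prob_space ?M
    by (rule prob_space_iid_samples)
  \<comment> \<open>The threshold at which Markov's inequality leaves failure probability exactly
    \<open>\<delta>\<close>.\<close>
  define K where "K = real (Suc J) * m / \<delta>"
  have K: "K > 0"
    using assms by (simp add: K_def)
  define I where "I j S = (\<integral>\<^sup>+x. ennreal (exp (f (deviation n S x))) \<partial>P j)" for j S
  have I [measurable]: "I j \<in> borel_measurable ?M" and I_le: "(\<integral>\<^sup>+S. I j S \<partial>?M) \<le> ennreal m"
    if j: "j \<le> J" for j
  proof -
    interpret P: prob_space "P j"
      using j by (rule P)
    note setsP[OF j, measurable_cong]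
    interpret pair_sigma_finite ?M "P j"
      by unfold_locales
    show "I j \<in> borel_measurable ?M"
      unfolding I_def by measurable
    have "(\<integral>\<^sup>+S. I j S \<partial>?M) = (\<integral>\<^sup>+x. (\<integral>\<^sup>+S. ennreal (exp (f (deviation n S x))) \<partial>?M) \<partial>P j)"
      unfolding I_def by (rule Fubini'[symmetric]) simp
    also have "\<dots> \<le> (\<integral>\<^sup>+x. ennreal m \<partial>P j)"
      by (intro nn_integral_mono m)
    finally show "(\<integral>\<^sup>+S. I j S \<partial>?M) \<le> ennreal m"
      by (simp add: P.emeasure_space_1)
  qed
  define \<Psi> where "\<Psi> S = (\<Sum>j\<le>J. I j S)" for S
  have [measurable]: "\<Psi> \<in> borel_measurable ?M"
    unfolding \<Psi>_def by measurable
  have "(\<integral>\<^sup>+S. \<Psi> S \<partial>?M) = (\<Sum>j\<le>J. \<integral>\<^sup>+S. I j S \<partial>?M)"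
    unfolding \<Psi>_def by (rule nn_integral_sum) simp
  also have "\<dots> \<le> (\<Sum>j\<le>J. ennreal m)"
    by (intro sum_mono I_le) simp
  also have "\<dots> = ennreal (real (Suc J) * m)"
    using \<open>m > 0\<close> by (simp add: ennreal_mult ennreal_of_nat_eq_real_of_nat)
  finally have \<Psi>_le: "(\<integral>\<^sup>+S. \<Psi> S \<partial>?M) \<le> ennreal (real (Suc J) * m)" .
  define E where "E = {S \<in> space ?M. \<Psi> S \<le> ennreal K}"
  have E [measurable]: "E \<in> sets ?M"
    unfolding E_def by measurable
  have "emeasure ?M (space ?M - E) \<le> emeasure ?M {S \<in> space ?M. 1 \<le> ennreal (1 / K) * \<Psi> S}"
  proof (intro emeasure_mono subsetI)
    fix S assume S: "S \<in> space ?M - E"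
    have "1 = ennreal (1 / K) * ennreal K"
      using K by (simp add: ennreal_mult[symmetric])
    also have "\<dots> \<le> ennreal (1 / K) * \<Psi> S"
      using S by (intro mult_left_mono) (auto simp: E_def)
    finally show "S \<in> {S \<in> space ?M. 1 \<le> ennreal (1 / K) * \<Psi> S}"
      using S by simp
  qed measurable
  also have "\<dots> \<le> ennreal (1 / K) * (\<integral>\<^sup>+S. \<Psi> S * indicator (space ?M) S \<partial>?M)"
    by (rule nn_integral_Markov_inequality) auto
  also have "(\<integral>\<^sup>+S. \<Psi> S * indicator (space ?M) S \<partial>?M) = (\<integral>\<^sup>+S. \<Psi> S \<partial>?M)"
    by (intro nn_integral_cong) simp
  also have "ennreal (1 / K) * \<dots> \<le> ennreal (1 / K) * ennreal (real (Suc J) * m)"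
    by (intro mult_left_mono \<Psi>_le) simp
  also have "\<dots> = ennreal \<delta>"
    using K \<open>m > 0\<close> \<open>\<delta> > 0\<close> by (subst ennreal_mult[symmetric]) (auto simp: K_def)
  finally have "S.prob (space ?M - E) \<le> \<delta>"
    using \<open>\<delta> > 0\<close> by (simp add: S.emeasure_eq_measure)
  then have "S.prob E \<ge> 1 - \<delta>"
    using S.prob_compl[OF E] by simp
  moreover have "I j S \<le> ennreal K" if "S \<in> E" "j \<le> J" for S j
  proof -
    have "I j S \<le> \<Psi> S"
      unfolding \<Psi>_def using that by (intro member_le_sum) auto
    then show ?thesis
      using that by (auto simp: E_def)
  qed
  ultimately show ?thesis
    using that[OF E] unfolding I_def K_def by blast
qed

end

section \<open>Fitting the cost of the grid into the stated logarithm\<close>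

text \<open>The grid has \<open>J + 1\<close> points, whereas the bound only pays for \<open>J\<close>.  For \<open>n \<ge> 4\<close> the factor
  \<open>\<surd>n\<close> from the square exponential moment leaves enough room, since \<open>(J + 1) \<surd>n \<le> n J\<close>.  For
  \<open>n = 2\<close> and \<open>n = 3\<close> a linear exponent is used instead; it is sufficient because only deviations
  between \<open>\<surd>(ln (n J / \<delta>) / (2 (n - 1)))\<close> and \<open>1\<close> matter.\<close>

lemma small_sample_slopes:
  fixes t :: real
  assumes n: "n = 2 \<or> n = 3" and t: "0 < t" "t \<le> 1" "ln (real n) < 2 * (real n - 1) * t\<^sup>2"
  defines "l \<equiv> if n = 2 then 5 / 2 else 5"
  shows "2 * (real n - 1) * t\<^sup>2 + l\<^sup>2 / (8 * real n) + ln (2 / real n) \<le> l * t"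
\<comment> \<open>The slope \<open>l\<close> is that of the chord of
  \<open>2 * (n - 1) * t\<^sup>2\<close> over the interval from 1/4 to 1. The parabola lies below
  this chord there, and the chord's constant term -(n - 1) / 2 pays for the two remaining summands.
  The hypothesis with \<open>ln n\<close> excludes \<open>t \<le> 1 / 4\<close>, since (n - 1) / 8
  is below 2/3.\<close>
proof (cases "n = 2")
  case True
  have "t > 1 / 4"
  proof (rule ccontr)
    assume "\<not> t > 1 / 4"
    then have "t\<^sup>2 \<le> (1 / 4)\<^sup>2"
      using t by (intro power_mono) auto
    then show False
      using t(3) True ln2_ge_two_thirds by (simp add: power2_eq_square)
  qed
  then have "(t - 1 / 4) * (1 - t) \<ge> 0"
    using t by simp
  then have "t * t \<le> 5 / 4 * t - 1 / 4"
    by (simp add: field_simps)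
  then show ?thesis
    using True \<open>t > 1 / 4\<close> by (simp add: l_def power2_eq_square algebra_simps)
next
  case False
  then have n: "n = 3"
    using n by simp
  have ln3: "ln (3 :: real) \<ge> ln 2"
    by simp
  have "t > 1 / 4"
  proof (rule ccontr)
    assume "\<not> t > 1 / 4"
    then have "t\<^sup>2 \<le> (1 / 4)\<^sup>2"
      using t by (intro power_mono) auto
    then show False
      using t(3) n ln3 ln2_ge_two_thirds by (simp add: power2_eq_square)
  qed
  then have "(t - 1 / 4) * (1 - t) \<ge> 0"
    using t by simp
  then have "t * t \<le> 5 / 4 * t - 1 / 4"
    by (simp add: field_simps)
  \<comment> \<open>For \<open>n = 3\<close> the Hoeffding term is 25/24, slightly more than the 1
    gained from the chord, so the negative logarithm has to help.\<close>
  moreover have "ln (2 / 3 :: real) \<le> - 1 / 3"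
    using ln_le_minus_one[of "2 / 3 :: real"] by simp
  ultimately show ?thesis
    using n \<open>t > 1 / 4\<close> by (simp add: l_def power2_eq_square algebra_simps)
qed

text \<open>If \<open>t\<close> exceeded the root, then \<open>a \<ge> 0\<close> and n J / \<delta>
  \<ge> n would place it in the range where the linear exponent dominates the square one,
  contradicting the assumed bound on \<open>l * t\<close>.\<close>

lemma le_sqrt_gap_of_linear:
  fixes a t \<delta> :: real and n J :: nat
  assumes n: "n = 2 \<or> n = 3" and J: "J \<ge> 1" and \<delta>: "0 < \<delta>" "\<delta> < 1" and a: "a \<ge> 0" and t: "t \<le> 1"
  defines "l \<equiv> if n = 2 then 5 / 2 else 5"
  assumes le: "l * t \<le> a + ln (real (Suc J) * exp (l\<^sup>2 / (8 * real n)) / \<delta>)"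
  shows "t \<le> sqrt ((a + ln (real n * real J / \<delta>)) / (2 * (real n - 1)))"
proof (rule ccontr)
  assume *: "\<not> ?thesis"
  have n0: "real n > 1"
    using n by auto
  have "real n * 1 \<le> real n * real J / \<delta>"
    using J \<delta> n0 by (simp add: field_simps mult_mono)
  then have ln_n: "ln (real n) \<le> ln (real n * real J / \<delta>)"
    using n0 by simp
  then have rhs: "a + ln (real n * real J / \<delta>) > 0"
    using a n0 by (smt (verit) ln_gt_zero)
  then have t0: "t > 0"
    using * n0 by (smt (verit) divide_pos_pos real_sqrt_gt_zero)
  have "\<not> t\<^sup>2 \<le> (a + ln (real n * real J / \<delta>)) / (2 * (real n - 1))"
    using * real_le_rsqrt by blast
  then have 1: "a + ln (real n * real J / \<delta>) < 2 * (real n - 1) * t\<^sup>2"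
    using n0 by (simp add: field_simps)
  \<comment> \<open>This is J + 1 \<le> 2 J; the factor \<open>2 / n\<close> is the source of
    \<open>ln (2 / n)\<close> in the comparison of exponents.\<close>
  have "real (Suc J) / \<delta> \<le> (real n * real J / \<delta>) * (2 / real n)"
    using J \<delta> n0 by (simp add: field_simps)
  then have "ln (real (Suc J) / \<delta>) \<le> ln ((real n * real J / \<delta>) * (2 / real n))"
    using \<delta> by (subst ln_le_cancel_iff) (use J n0 in auto)
  also have "\<dots> = ln (real n * real J / \<delta>) + ln (2 / real n)"
    using J n0 \<delta> by (intro ln_mult_pos) auto
  finally have 2: "ln (real (Suc J) / \<delta>) \<le> ln (real n * real J / \<delta>) + ln (2 / real n)" .
  have "ln (real (Suc J) * exp (l\<^sup>2 / (8 * real n)) / \<delta>) = ln (real (Suc J) / \<delta> * exp (l\<^sup>2 / (8 * real n)))"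
    by simp
  also have "\<dots> = ln (real (Suc J) / \<delta>) + l\<^sup>2 / (8 * real n)"
    using \<delta> by (subst ln_mult_pos) auto
  finally have 3: "ln (real (Suc J) * exp (l\<^sup>2 / (8 * real n)) / \<delta>) = ln (real (Suc J) / \<delta>) + l\<^sup>2 / (8 * real n)" .
  have "2 * (real n - 1) * t\<^sup>2 + l\<^sup>2 / (8 * real n) + ln (2 / real n) \<le> l * t"
    unfolding l_def using n t0 t 1 ln_n a by (intro small_sample_slopes) auto
  then show False
    using le 1 2 3 by linarith
qed

lemma le_sqrt_gap_of_square:
  fixes a t \<delta> :: real and n J :: nat
  assumes n: "n \<ge> 4" and J: "J \<ge> 1" and \<delta>: "0 < \<delta>"
    and le: "2 * (real n - 1) * t\<^sup>2 \<le> a + ln (real (Suc J) * sqrt n / \<delta>)"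
  shows "t \<le> sqrt ((a + ln (real n * real J / \<delta>)) / (2 * (real n - 1)))"
proof (rule real_le_rsqrt)
  \<comment> \<open>Together with J + 1 \<le> 2 J this suffices; both are equalities for
    \<open>n = 4\<close> and \<open>J = 1\<close>, so the square exponent has no slack
    there.\<close>
  have "2 \<le> sqrt n"
    using n by (intro real_le_rsqrt) simp
  then have "2 * sqrt n \<le> sqrt n * sqrt n"
    by (intro mult_right_mono) auto
  then have "2 * sqrt n \<le> real n"
    by simp
  have "real (Suc J) * sqrt n \<le> (2 * real J) * sqrt n"
    using J by (intro mult_right_mono) auto
  also have "\<dots> \<le> real n * real J"
    using mult_left_mono[OF \<open>2 * sqrt n \<le> real n\<close>, of "real J"] by (simp add: ac_simps)
  finally have "ln (real (Suc J) * sqrt n / \<delta>) \<le> ln (real n * real J / \<delta>)"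
    using n J \<delta> by (subst ln_le_cancel_iff) (auto intro!: divide_right_mono)
  then show "t\<^sup>2 \<le> (a + ln (real n * real J / \<delta>)) / (2 * (real n - 1))"
    using le n by (simp add: field_simps)
qed

section \<open>Generalization bounds for Gaussian posteriors\<close>

text \<open>A general convex \<open>f\<close> covers both the square and the linear exponent.
  Jensen's inequality moves \<open>f\<close> outside the posterior mean. Deviations lie between -1
  and 1, so \<open>B\<close> makes \<open>f\<close> and \<open>exp f\<close> of them integrable.
  \<open>\<mu>\<close> and \<open>c\<close> are quantified after \<open>E\<close>, which lets them
  depend on the sample.\<close>

lemma spherical_gaussian_deviation_event:
  fixes loss :: "real ^ 'd \<Rightarrow> 'z \<Rightarrow> real" and J :: nat and m \<delta> :: real and v :: "nat \<Rightarrow> real"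
  assumes "bounded_loss D loss"
    and v: "\<And>j. j \<le> J \<Longrightarrow> v j > 0"
    and f [measurable]: "f \<in> borel_measurable borel" and conv: "convex_on UNIV f"
    and B: "\<And>t. \<bar>t\<bar> \<le> 1 \<Longrightarrow> \<bar>f t\<bar> \<le> B"
    and m: "\<And>x. (\<integral>\<^sup>+S. ennreal (exp (f (bounded_loss.deviation D loss n S x))) \<partial>iid_samples n D) \<le> ennreal m"
    and "m > 0" "\<delta> > 0"
  obtains E where "E \<in> sets (iid_samples n D)" "measure (iid_samples n D) E \<ge> 1 - \<delta>"
    "\<And>S j \<mu> c. S \<in> E \<Longrightarrow> j \<le> J \<Longrightarrow> c > 0 \<Longrightarrow>
      f (\<integral>x. bounded_loss.deviation D loss n S x \<partial>spherical_gaussian \<mu> (c * v j))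
      \<le> CARD('d) / 2 * (c - 1 - ln c) + (norm \<mu>)\<^sup>2 / (2 * v j) + ln (real (Suc J) * m / \<delta>)"
proof -
  interpret bounded_loss D loss
    by fact
  define K where "K = real (Suc J) * m / \<delta>"
  obtain E where E: "E \<in> sets (iid_samples n D)" "measure (iid_samples n D) E \<ge> 1 - \<delta>"
    and avg: "\<And>S j. S \<in> E \<Longrightarrow> j \<le> J \<Longrightarrow>
      (\<integral>\<^sup>+x. ennreal (exp (f (deviation n S x))) \<partial>spherical_gaussian 0 (v j)) \<le> ennreal K"
    unfolding K_def
    by (rule prior_average_event[of J "\<lambda>j. spherical_gaussian 0 (v j)", OF
          prob_space_spherical_gaussian[OF v] sets_spherical_gaussian f m \<open>m > 0\<close> \<open>\<delta> > 0\<close>])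
       blast+
  have "f (\<integral>x. deviation n S x \<partial>spherical_gaussian \<mu> (c * v j))
      \<le> CARD('d) / 2 * (c - 1 - ln c) + (norm \<mu>)\<^sup>2 / (2 * v j) + ln K"
    if S: "S \<in> E" and j: "j \<le> J" and c: "c > 0" for S j \<mu> c
  proof -
    let ?P = "spherical_gaussian (0 :: real ^ 'd) (v j)" and ?Q = "spherical_gaussian \<mu> (c * v j)"
    have space: "S \<in> space (iid_samples n D)"
      using S E(1) sets.sets_into_space by blast
    note bnd = deviation_bounds[OF space]
    have [measurable]: "deviation n S \<in> borel_measurable borel"
      using measurable_Pair2[OF deviation_measurable space] by simp
    interpret P: prob_space ?P
      using v[OF j] by (rule prob_space_spherical_gaussian)
    interpret Q: prob_space ?Q
      using v[OF j] c by (intro prob_space_spherical_gaussian) simp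
    have "f (\<integral>x. deviation n S x \<partial>?Q) \<le> (\<integral>x. f (deviation n S x) \<partial>?Q)"
    proof (rule Q.jensens_inequality[where I = UNIV])
      show "integrable ?Q (deviation n S)"
        using bnd by (intro Q.integrable_const_bound[where B = 1]) auto
      show "integrable ?Q (\<lambda>x. f (deviation n S x))"
        using B bnd by (intro Q.integrable_const_bound[where B = B]) auto
    qed (use conv in auto)
    also have "\<dots> \<le> CARD('d) / 2 * (c - 1 - ln c) + (norm \<mu>)\<^sup>2 / (2 * v j)
        + ln (\<integral>x. exp (f (deviation n S x)) \<partial>?P)"
      using B bnd v[OF j] c by (intro spherical_gaussian_change_of_measure_le[where B = B]) auto
    also have "ln (\<integral>x. exp (f (deviation n S x)) \<partial>?P) \<le> ln K"
    proof (rule ln_mono)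
      have fB: "- B \<le> f (deviation n S x)" "f (deviation n S x) \<le> B" for x
        using B[OF bnd, of x] by linarith+
      then have int: "integrable ?P (\<lambda>x. exp (f (deviation n S x)))"
        by (intro P.integrable_const_bound[where B = "exp B"]) auto
      \<comment> \<open>Monotonicity of \<open>ln\<close> needs a positive argument; the bound
        \<open>B\<close> keeps the prior average away from 0.\<close>
      have "exp (- B) \<le> (\<integral>x. exp (f (deviation n S x)) \<partial>?P)"
        using fB by (intro P.integral_ge_const int) simp
      then show "(\<integral>x. exp (f (deviation n S x)) \<partial>?P) > 0"
        by (rule less_le_trans[rotated]) simp
      have "ennreal (\<integral>x. exp (f (deviation n S x)) \<partial>?P) \<le> ennreal K"
        using avg[OF S j] int by (subst (asm) nn_integral_eq_integral) auto
      then show "(\<integral>x. exp (f (deviation n S x)) \<partial>?P) \<le> K"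
        using \<open>m > 0\<close> \<open>\<delta> > 0\<close> by (simp add: K_def)
    qed
    finally show ?thesis
      by simp
  qed
  then show ?thesis
    using that[OF E] by (simp add: K_def)
qed

lemma spherical_gaussian_generalization_event:
  fixes loss :: "real ^ 'd \<Rightarrow> 'z \<Rightarrow> real" and n J :: nat and \<delta> :: real and v :: "nat \<Rightarrow> real"
  assumes "bounded_loss D loss" and n: "n \<ge> 2" and J: "J \<ge> 1" and \<delta>: "0 < \<delta>" "\<delta> < 1"
    and v: "\<And>j. j \<le> J \<Longrightarrow> v j > 0"
  obtains E where "E \<in> sets (iid_samples n D)" "measure (iid_samples n D) E \<ge> 1 - \<delta>"
    "\<And>S j \<mu> c. S \<in> E \<Longrightarrow> j \<le> J \<Longrightarrow> c > 0 \<Longrightarrow>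
      (\<integral>x. bounded_loss.deviation D loss n S x \<partial>spherical_gaussian \<mu> (c * v j))
      \<le> sqrt ((CARD('d) / 2 * (c - 1 - ln c) + (norm \<mu>)\<^sup>2 / (2 * v j) + ln (real n * real J / \<delta>))
          / (2 * (real n - 1)))"
proof -
  interpret bounded_loss D loss
    by fact
  show ?thesis
  proof (cases "n \<ge> 4")
    case True
    define f where "f t = 2 * (real n - 1) * t\<^sup>2" for t :: real
    have conv: "convex_on UNIV f"
      unfolding f_def using n by (intro convex_on_cmul convex_power2) auto
    have B: "\<bar>f t\<bar> \<le> 2 * (real n - 1)" if "\<bar>t\<bar> \<le> 1" for t
    proof -
      have "t\<^sup>2 \<le> 1"
        using that by (simp add: abs_square_le_1)
      then show ?thesis
        unfolding f_def abs_mult using n mult_left_mono[of "t\<^sup>2" 1 "2 * (real n - 1)"] by simp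
    qed
    have m: "(\<integral>\<^sup>+S. ennreal (exp (f (deviation n S x))) \<partial>iid_samples n D) \<le> ennreal (sqrt n)" for x
      unfolding f_def using n by (intro exp_square_deviation_le) simp
    have f [measurable]: "f \<in> borel_measurable borel"
      unfolding f_def by measurable
    have "sqrt n > 0"
      using n by simp
    obtain E where E: "E \<in> sets (iid_samples n D)" "measure (iid_samples n D) E \<ge> 1 - \<delta>"
      and le: "\<And>S j \<mu> c. S \<in> E \<Longrightarrow> j \<le> J \<Longrightarrow> c > 0 \<Longrightarrow>
        f (\<integral>x. deviation n S x \<partial>spherical_gaussian \<mu> (c * v j))
        \<le> CARD('d) / 2 * (c - 1 - ln c) + (norm \<mu>)\<^sup>2 / (2 * v j) + ln (real (Suc J) * sqrt n / \<delta>)"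
      by (rule spherical_gaussian_deviation_event[OF \<open>bounded_loss D loss\<close> v f conv B m \<open>sqrt n > 0\<close> \<open>\<delta> > 0\<close>])
         blast+
    show ?thesis
      using le_sqrt_gap_of_square[OF True J \<open>\<delta> > 0\<close>] le unfolding f_def by (intro that[OF E]) blast
  next
    case False
    then have n23: "n = 2 \<or> n = 3"
      using n by linarith
    define l :: real where "l = (if n = 2 then 5 / 2 else 5)"
    have l: "l > 0"
      by (simp add: l_def)
    define f where "f t = l * t" for t :: real
    have conv: "convex_on UNIV f"
      unfolding f_def using l by (intro convex_on_cmul) (auto simp: convex_on_ident)
    have B: "\<bar>f t\<bar> \<le> l" if "\<bar>t\<bar> \<le> 1" for t
      using that l by (simp add: f_def abs_mult)
    have m: "(\<integral>\<^sup>+S. ennreal (exp (f (deviation n S x))) \<partial>iid_samples n D) \<le> ennreal (exp (l\<^sup>2 / (8 * real n)))"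
      for x
      unfolding f_def using n by (intro mgf_deviation_le) simp
    have f [measurable]: "f \<in> borel_measurable borel"
      unfolding f_def by measurable
    obtain E where E: "E \<in> sets (iid_samples n D)" "measure (iid_samples n D) E \<ge> 1 - \<delta>"
      and le: "\<And>S j \<mu> c. S \<in> E \<Longrightarrow> j \<le> J \<Longrightarrow> c > 0 \<Longrightarrow>
        f (\<integral>x. deviation n S x \<partial>spherical_gaussian \<mu> (c * v j))
        \<le> CARD('d) / 2 * (c - 1 - ln c) + (norm \<mu>)\<^sup>2 / (2 * v j)
          + ln (real (Suc J) * exp (l\<^sup>2 / (8 * real n)) / \<delta>)"
      by (rule spherical_gaussian_deviation_event[OF \<open>bounded_loss D loss\<close> v f conv B m exp_gt_zero \<open>\<delta> > 0\<close>])
         blast+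
    show ?thesis
    proof (rule that[OF E])
      fix S j \<mu> and c :: real
      assume S: "S \<in> E" and j: "j \<le> J" and c: "c > 0"
      let ?Q = "spherical_gaussian \<mu> (c * v j) :: (real ^ 'd) measure"
      interpret Q: prob_space ?Q
        using v[OF j] c by (intro prob_space_spherical_gaussian) simp
      have space: "S \<in> space (iid_samples n D)"
        using S E(1) sets.sets_into_space by blast
      have [measurable]: "deviation n S \<in> borel_measurable borel"
        using measurable_Pair2[OF deviation_measurable space] by simp
      \<comment> \<open>The linear exponent beats the square one only up to 1, so the trivial bound
        on the mean deviation is supplied as well.\<close>
      have "(\<integral>x. deviation n S x \<partial>?Q) \<le> 1"
        using deviation_bounds[OF space]
        by (intro Q.integral_le_const Q.integrable_const_bound[where B = 1]) (auto simp: abs_le_iff)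
      moreover have "CARD('d) / 2 * (c - 1 - ln c) + (norm \<mu>)\<^sup>2 / (2 * v j) \<ge> 0"
        using ln_le_minus_one[OF c] v[OF j] by (intro add_nonneg_nonneg mult_nonneg_nonneg) auto
      ultimately show "(\<integral>x. deviation n S x \<partial>?Q)
          \<le> sqrt ((CARD('d) / 2 * (c - 1 - ln c) + (norm \<mu>)\<^sup>2 / (2 * v j) + ln (real n * real J / \<delta>))
              / (2 * (real n - 1)))"
        using le[OF S j c, of \<mu>] le_sqrt_gap_of_linear[OF n23 J \<delta>] unfolding f_def l_def by blast
    qed
  qed
qed

section \<open>Monotonicity of the gap, and the theorem\<close>

text \<open>Strictness comes from the term with \<open>r\<close>. The function c - 1 - ln c is
  nondecreasing from 1 on, because \<open>ln (c / c')\<close> is at most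
  \<open>(c - c') / c'\<close>, hence at most \<open>c - c'\<close>.\<close>

lemma gap_strict_mono:
  assumes "n \<ge> 2" "0 < D0" "0 < \<sigma>" "\<beta> < 1" "0 < r" "r < r'" "1 \<le> c'" "c' \<le> c"
  shows "gap d n J \<delta> \<sigma> D0 \<beta> c' r' < gap d n J \<delta> \<sigma> D0 \<beta> c r"
proof -
  have "ln c - ln c' = ln (c / c')"
    using assms by (simp add: ln_div)
  also have "\<dots> \<le> c / c' - 1"
    using assms by (intro ln_le_minus_one) auto
  also have "\<dots> \<le> c - c'"
    using mult_left_mono[of 1 c' "c - c'"] assms by (simp add: field_simps)
  finally have "d / 2 * (c' - 1 - ln c') \<le> d / 2 * (c - 1 - ln c)"
    by (intro mult_left_mono) auto
  moreover have "D0 / (2 * \<sigma>\<^sup>2 * r' powr (1 - \<beta>)) < D0 / (2 * \<sigma>\<^sup>2 * r powr (1 - \<beta>))"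
    using assms by (intro divide_strict_left_mono mult_strict_left_mono powr_less_mono2 mult_pos_pos) auto
  ultimately show ?thesis
    \<comment> \<open>\<open>sqrt\<close> extends to negative reals as an odd function and is
      strictly increasing everywhere, so the sign of the numerator does not matter.\<close>
    unfolding gap_def using assms by (intro real_sqrt_less_mono divide_strict_right_mono) auto
qed

text \<open>The gap also grows with the scale \<open>c\<close>, so a large enough increase of
  \<open>c\<close> from one radius to the next would outweigh the gain from the radius. The decrease
  is therefore claimed for consecutive radii at which \<open>c\<close> does not increase.\<close>

theorem theorem2:
  fixes D :: "'z measure"
    and loss :: "real ^ 'd \<Rightarrow> 'z \<Rightarrow> real"
    and n J :: nat
    and \<delta> \<sigma>\<^sub>0 D\<^sub>0 \<beta> r_min \<gamma> :: real
    and pull push r :: "nat \<Rightarrow> real"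
    and P :: "real \<Rightarrow> (real ^ 'd) measure"
    and train :: "real \<Rightarrow> real \<Rightarrow> (nat \<Rightarrow> 'z) \<Rightarrow> (real ^ 'd) measure"
    and \<mu> :: "real \<Rightarrow> (nat \<Rightarrow> 'z) \<Rightarrow> real ^ 'd"
    and c :: "real \<Rightarrow> (nat \<Rightarrow> 'z) \<Rightarrow> real"
  assumes "prob_space D"
    and "(\<lambda>(x, z). loss x z) \<in> borel_measurable (borel \<Otimes>\<^sub>M D)"
    and "\<And>x z. z \<in> space D \<Longrightarrow> 0 \<le> loss x z \<and> loss x z \<le> 1"
    and "2 \<le> n" and "1 \<le> J"
    and "0 < \<delta>" and "\<delta> < 1" and "0 < \<sigma>\<^sub>0"
    and "0 < r_min" and "0 < \<gamma>"
    and "\<And>j. j \<le> J \<Longrightarrow> r j = r_min * (1 + \<gamma>) ^ j"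
    and "\<And>j. j \<le> J \<Longrightarrow> 0 < pull j \<and> 0 < push j \<and> r j = push j / pull j"
    and "\<And>j. j \<le> J \<Longrightarrow> P (r j) = spherical_gaussian 0 (r j * \<sigma>\<^sub>0\<^sup>2)"
    and "\<And>j S. j \<le> J \<Longrightarrow> S \<in> space (iid_samples n D) \<Longrightarrow>
           train (pull j) (push j) S = spherical_gaussian (\<mu> (r j) S) (c (r j) S * r j * \<sigma>\<^sub>0\<^sup>2)"
    and "\<And>j S. j \<le> J \<Longrightarrow> S \<in> space (iid_samples n D) \<Longrightarrow> 1 \<le> c (r j) S"
    and "0 < D\<^sub>0" and "0 \<le> \<beta>" and "\<beta> < 1"
    and "\<And>j S. j \<le> J \<Longrightarrow> S \<in> space (iid_samples n D) \<Longrightarrow>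
           (norm (\<mu> (r j) S))\<^sup>2 \<le> D\<^sub>0 * r j powr \<beta>"
  shows "(\<exists>E \<in> sets (iid_samples n D).
            measure (iid_samples n D) E \<ge> 1 - \<delta> \<and>
            (\<forall>S\<in>E. \<forall>j\<le>J.
               (\<integral>x. population_loss D loss x \<partial>train (pull j) (push j) S)
               \<le> (\<integral>x. empirical_loss n loss S x \<partial>train (pull j) (push j) S)
                 + gap CARD('d) n J \<delta> \<sigma>\<^sub>0 D\<^sub>0 \<beta> (c (r j) S) (r j)))
       \<and> (\<forall>S \<in> space (iid_samples n D). \<forall>j<J.
            c (r (Suc j)) S \<le> c (r j) S \<longrightarrow>
            gap CARD('d) n J \<delta> \<sigma>\<^sub>0 D\<^sub>0 \<beta> (c (r (Suc j)) S) (r (Suc j))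
            < gap CARD('d) n J \<delta> \<sigma>\<^sub>0 D\<^sub>0 \<beta> (c (r j) S) (r j))"
proof (rule conjI)
  note n = \<open>2 \<le> n\<close> and \<sigma> = \<open>0 < \<sigma>\<^sub>0\<close> and D\<^sub>0 = \<open>0 < D\<^sub>0\<close> and r = assms(11) and train = assms(14)
    and c1 = assms(15) and mu = assms(19)
  interpret prob_space D
    by fact
  have bl: "bounded_loss D loss"
    using assms(2,3) by unfold_locales auto
  interpret bounded_loss D loss
    by (rule bl)
  have r_pos: "r j > 0" if "j \<le> J" for j
    using r[OF that] \<open>0 < r_min\<close> \<open>0 < \<gamma>\<close> by simp
  then have v: "r j * \<sigma>\<^sub>0\<^sup>2 > 0" if "j \<le> J" for j
    using that \<sigma> by simp
  obtain E where E: "E \<in> sets (iid_samples n D)" "measure (iid_samples n D) E \<ge> 1 - \<delta>"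
    and le: "\<And>S j \<mu> c. S \<in> E \<Longrightarrow> j \<le> J \<Longrightarrow> c > 0 \<Longrightarrow>
      (\<integral>x. deviation n S x \<partial>spherical_gaussian \<mu> (c * (r j * \<sigma>\<^sub>0\<^sup>2)))
      \<le> sqrt ((CARD('d) / 2 * (c - 1 - ln c) + (norm \<mu>)\<^sup>2 / (2 * (r j * \<sigma>\<^sub>0\<^sup>2)) + ln (real n * real J / \<delta>))
          / (2 * (real n - 1)))"
    by (rule spherical_gaussian_generalization_event[OF bl n \<open>1 \<le> J\<close> \<open>0 < \<delta>\<close> \<open>\<delta> < 1\<close> v]) blast+
  have "(\<integral>x. population_loss D loss x \<partial>train (pull j) (push j) S)
      \<le> (\<integral>x. empirical_loss n loss S x \<partial>train (pull j) (push j) S)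
        + gap CARD('d) n J \<delta> \<sigma>\<^sub>0 D\<^sub>0 \<beta> (c (r j) S) (r j)" if S: "S \<in> E" and j: "j \<le> J" for S j
  proof -
    have space: "S \<in> space (iid_samples n D)"
      using S E(1) sets.sets_into_space by blast
    let ?c = "c (r j) S" and ?\<mu> = "\<mu> (r j) S"
    let ?Q = "spherical_gaussian ?\<mu> (?c * (r j * \<sigma>\<^sub>0\<^sup>2))"
    have c: "?c \<ge> 1"
      using j space by (rule c1)
    interpret Q: prob_space ?Q
      using v[OF j] c by (intro prob_space_spherical_gaussian) simp
    have [measurable]: "empirical_loss n loss S \<in> borel_measurable borel"
      using measurable_Pair2[OF empirical_loss_measurable space] by simp
    have int: "integrable ?Q (population_loss D loss)" "integrable ?Q (empirical_loss n loss S)"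
      using population_loss_bounds empirical_loss_bounds[OF space]
      by (auto intro!: Q.integrable_const_bound[where B = 1])
    have "(norm ?\<mu>)\<^sup>2 / (2 * (r j * \<sigma>\<^sub>0\<^sup>2)) \<le> D\<^sub>0 * r j powr \<beta> / (2 * (r j * \<sigma>\<^sub>0\<^sup>2))"
      using mu[OF j space] v[OF j] by (intro divide_right_mono) auto
    also have "\<dots> = D\<^sub>0 / (2 * \<sigma>\<^sub>0\<^sup>2 * r j powr (1 - \<beta>))"
      using r_pos[OF j] \<sigma> by (simp add: powr_diff field_simps)
    finally have "(norm ?\<mu>)\<^sup>2 / (2 * (r j * \<sigma>\<^sub>0\<^sup>2)) \<le> D\<^sub>0 / (2 * \<sigma>\<^sub>0\<^sup>2 * r j powr (1 - \<beta>))" .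
    then have "sqrt ((CARD('d) / 2 * (?c - 1 - ln ?c) + (norm ?\<mu>)\<^sup>2 / (2 * (r j * \<sigma>\<^sub>0\<^sup>2))
        + ln (real n * real J / \<delta>)) / (2 * (real n - 1))) \<le> gap CARD('d) n J \<delta> \<sigma>\<^sub>0 D\<^sub>0 \<beta> ?c (r j)"
      unfolding gap_def using n by (intro real_sqrt_le_mono divide_right_mono add_mono) auto
    with le[OF S j, of ?c ?\<mu>] c
    have "(\<integral>x. deviation n S x \<partial>?Q) \<le> gap CARD('d) n J \<delta> \<sigma>\<^sub>0 D\<^sub>0 \<beta> ?c (r j)"
      by linarith
    then show ?thesis
      using int train[OF j space] by (simp add: deviation_def mult.assoc)
  qed
  with E show "\<exists>E \<in> sets (iid_samples n D).
            measure (iid_samples n D) E \<ge> 1 - \<delta> \<and>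
            (\<forall>S\<in>E. \<forall>j\<le>J.
               (\<integral>x. population_loss D loss x \<partial>train (pull j) (push j) S)
               \<le> (\<integral>x. empirical_loss n loss S x \<partial>train (pull j) (push j) S)
                 + gap CARD('d) n J \<delta> \<sigma>\<^sub>0 D\<^sub>0 \<beta> (c (r j) S) (r j))"
    by blast
  show "\<forall>S \<in> space (iid_samples n D). \<forall>j<J.
            c (r (Suc j)) S \<le> c (r j) S \<longrightarrow>
            gap CARD('d) n J \<delta> \<sigma>\<^sub>0 D\<^sub>0 \<beta> (c (r (Suc j)) S) (r (Suc j))
            < gap CARD('d) n J \<delta> \<sigma>\<^sub>0 D\<^sub>0 \<beta> (c (r j) S) (r j)"
  proof (intro ballI allI impI)
    fix S j
    assume S: "S \<in> space (iid_samples n D)" and j: "j < J" and le: "c (r (Suc j)) S \<le> c (r j) S"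
    have "r (Suc j) = r j * (1 + \<gamma>)"
      using j by (simp add: r)
    then have "r j < r (Suc j)"
      using r_pos[of j] j \<open>0 < \<gamma>\<close> by simp
    then show "gap CARD('d) n J \<delta> \<sigma>\<^sub>0 D\<^sub>0 \<beta> (c (r (Suc j)) S) (r (Suc j))
            < gap CARD('d) n J \<delta> \<sigma>\<^sub>0 D\<^sub>0 \<beta> (c (r j) S) (r j)"
      using r_pos[of j] j le c1[of "Suc j" S] S n D\<^sub>0 \<sigma> \<open>\<beta> < 1\<close> by (intro gap_strict_mono) auto
  qed
qed

end
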